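(* Let $n\ge2$ with $n\equiv 1\pmod 4$. Then the number of equiparity Latin squares in the ensemble of any $\mathrm{OA}(n+1,n)$ is at least $(n+1)(n-1)(n-3)/24$.
   Context: An orthogonal array $\mathrm{OA}(k,n)$ on an alphabet $\Lambda$ with $|\Lambda|=n$ is an $n^2\times k$ matrix $A=(a_{r\ell})$ with entries in $\Lambda$ such that in every pair of distinct columns each ordered pair in $\Lambda^2$ occurs in exactly one row. The ensemble of $A$ is the family of Latin squares indexed by the $\binom{k}{3}$ choices of columns $i<j<\ell$ of $A$ (Latin squares are counted once for each choice of three columns): the Latin square for $i<j<\ell$ has rows and columns indexed by $\Lambda$, and for each row $r$ of $A$ its entry in row $a_{ri}$, column $a_{rj}$ is $a_{r\ell}$. For a Latin square $L=(l_{xy})$ with rows, columns and symbols indexed by $\Lambda$, the row-parity $\pi_r\in\mathbb{Z}_2$ is the sum of the parities ($0$ even, $1$ odd) of the $n$ permutations $y\mapsto l_{xy}$ ($x\in\Lambda$ fixed); the column-parity $\pi_c$ is the sum of the parities of the $n$ permutations $x\mapsto l_{xy}$ ($y$ fixed); the symbol-parity $\pi_s$ is the sum of the parities of the $n$ permutations mapping $x\mapsto y$ whenever $l_{xy}=s$ ($s$ fixed). $L$ is equiparity if $\pi_r=\pi_c=\pi_s$. *)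

theory Defs
  imports Complex_Main "HOL-Combinatorics.Permutations" "HOL-Library.Z2"
begin

text \<open>
  A matrix is a function of a row index and a column index, both counted from 0. Entries outside
  the stated ranges play no role.
\<close>

definition orthogonal_array :: "nat \<Rightarrow> nat \<Rightarrow> 'a set \<Rightarrow> (nat \<Rightarrow> nat \<Rightarrow> 'a) \<Rightarrow> bool" where
  "orthogonal_array k n \<Lambda> A \<longleftrightarrow>
     finite \<Lambda> \<and> card \<Lambda> = n \<and>
     (\<forall>r<n\<^sup>2. \<forall>c<k. A r c \<in> \<Lambda>) \<and>
     (\<forall>c<k. \<forall>d<k. c \<noteq> d \<longrightarrow>
        (\<forall>x\<in>\<Lambda>. \<forall>y\<in>\<Lambda>. \<exists>!r. r < n\<^sup>2 \<and> A r c = x \<and> A r d = y))"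

text \<open>\<open>L x y\<close> is the entry in row \<open>x\<close> and column \<open>y\<close>.\<close>

definition latin_square :: "'a set \<Rightarrow> ('a \<Rightarrow> 'a \<Rightarrow> 'a) \<Rightarrow> bool" where
  "latin_square \<Lambda> L \<longleftrightarrow>
     (\<forall>x\<in>\<Lambda>. bij_betw (\<lambda>y. L x y) \<Lambda> \<Lambda>) \<and> (\<forall>y\<in>\<Lambda>. bij_betw (\<lambda>x. L x y) \<Lambda> \<Lambda>)"

definition ensemble_square ::
    "nat \<Rightarrow> (nat \<Rightarrow> nat \<Rightarrow> 'a) \<Rightarrow> nat \<Rightarrow> nat \<Rightarrow> nat \<Rightarrow> 'a \<Rightarrow> 'a \<Rightarrow> 'a" where
  "ensemble_square n A i j l = (\<lambda>x y. THE s. \<exists>r<n\<^sup>2. A r i = x \<and> A r j = y \<and> A r l = s)"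

text \<open>
  \<^const>\<open>evenperm\<close> concerns permutations of a whole type, so a permutation of \<open>\<Lambda>\<close> is first extended
  by the identity. The type \<^typ>\<open>bit\<close> is the field with two elements.
\<close>

definition perm_parity :: "'a set \<Rightarrow> ('a \<Rightarrow> 'a) \<Rightarrow> bit" where
  "perm_parity \<Lambda> f = (if evenperm (restrict_id f \<Lambda>) then 0 else 1)"

definition row_parity :: "'a set \<Rightarrow> ('a \<Rightarrow> 'a \<Rightarrow> 'a) \<Rightarrow> bit" where
  "row_parity \<Lambda> L = (\<Sum>x\<in>\<Lambda>. perm_parity \<Lambda> (\<lambda>y. L x y))"

definition column_parity :: "'a set \<Rightarrow> ('a \<Rightarrow> 'a \<Rightarrow> 'a) \<Rightarrow> bit" where
  "column_parity \<Lambda> L = (\<Sum>y\<in>\<Lambda>. perm_parity \<Lambda> (\<lambda>x. L x y))"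

definition symbol_parity :: "'a set \<Rightarrow> ('a \<Rightarrow> 'a \<Rightarrow> 'a) \<Rightarrow> bit" where
  "symbol_parity \<Lambda> L = (\<Sum>s\<in>\<Lambda>. perm_parity \<Lambda> (\<lambda>x. THE y. y \<in> \<Lambda> \<and> L x y = s))"

definition equiparity_latin_square :: "'a set \<Rightarrow> ('a \<Rightarrow> 'a \<Rightarrow> 'a) \<Rightarrow> bool" where
  "equiparity_latin_square \<Lambda> L \<longleftrightarrow>
     latin_square \<Lambda> L \<and> row_parity \<Lambda> L = column_parity \<Lambda> L \<and> column_parity \<Lambda> L = symbol_parity \<Lambda> L"

lemma ensemble_square_eq:
  assumes OA: "orthogonal_array k n \<Lambda> A" and c: "i < k" "j < k" "i \<noteq> j" and r: "r < n\<^sup>2"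
  shows "ensemble_square n A i j l (A r i) (A r j) = A r l"
  unfolding ensemble_square_def
proof (rule the_equality)
  show "\<exists>q<n\<^sup>2. A q i = A r i \<and> A q j = A r j \<and> A q l = A r l"
    using r by blast
next
  fix s assume "\<exists>q<n\<^sup>2. A q i = A r i \<and> A q j = A r j \<and> A q l = s"
  then obtain q where q: "q < n\<^sup>2" "A q i = A r i" "A q j = A r j" "A q l = s" by blast
  have "A r i \<in> \<Lambda>" "A r j \<in> \<Lambda>" using OA c r by (auto simp: orthogonal_array_def)
  then have "\<exists>!p. p < n\<^sup>2 \<and> A p i = A r i \<and> A p j = A r j"
    using OA c by (auto simp: orthogonal_array_def)
  then have "q = r" using q r by blast
  then show "s = A r l" using q by simp
qed

lemma latin_square_ensemble_square:
  assumes OA: "orthogonal_array k n \<Lambda> A" and c: "i < k" "j < k" "l < k" "i \<noteq> j" "i \<noteq> l" "j \<noteq> l"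
  shows "latin_square \<Lambda> (ensemble_square n A i j l)"
proof -
  let ?L = "ensemble_square n A i j l"
  have mem: "A r d \<in> \<Lambda>" if "r < n\<^sup>2" "d < k" for r d
    using OA that by (auto simp: orthogonal_array_def)
  have ex1: "\<exists>!r. r < n\<^sup>2 \<and> A r d = x \<and> A r e = y"
    if "d < k" "e < k" "d \<noteq> e" "x \<in> \<Lambda>" "y \<in> \<Lambda>" for d e x y
    using OA that by (auto simp: orthogonal_array_def)
  note L = ensemble_square_eq[OF OA c(1,2,4)]
  have fin: "finite \<Lambda>" using OA by (simp add: orthogonal_array_def)
  have closed: "?L x y \<in> \<Lambda>" if xy: "x \<in> \<Lambda>" "y \<in> \<Lambda>" for x y
    using ex1[OF c(1,2,4) xy] L mem c by metis
  have row: "s \<in> ?L x ` \<Lambda>" if xs: "x \<in> \<Lambda>" "s \<in> \<Lambda>" for x s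
  proof -
    obtain r where "r < n\<^sup>2" "A r i = x" "A r l = s" using ex1[OF c(1,3,5) xs] by blast
    then show ?thesis using L[of r l] mem[of r j] c by force
  qed
  have col: "s \<in> (\<lambda>x. ?L x y) ` \<Lambda>" if ys: "y \<in> \<Lambda>" "s \<in> \<Lambda>" for y s
  proof -
    obtain r where "r < n\<^sup>2" "A r j = y" "A r l = s" using ex1[OF c(2,3,6) ys] by blast
    then show ?thesis using L[of r l] mem[of r i] c by force
  qed
  have bij: "bij_betw f \<Lambda> \<Lambda>" if "f ` \<Lambda> = \<Lambda>" for f :: "'a \<Rightarrow> 'a"
    using fin that by (simp add: bij_betw_def finite_surj_inj)
  have "?L x ` \<Lambda> = \<Lambda>" if "x \<in> \<Lambda>" for x
    using row closed that by blast
  moreover have "(\<lambda>x. ?L x y) ` \<Lambda> = \<Lambda>" if "y \<in> \<Lambda>" for y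
    using col closed that by blast
  ultimately show ?thesis
    unfolding latin_square_def by (simp add: bij)
qed

end

theory Submission
  imports Defs
begin

text \<open>
  Fix an enumeration of the rows by \<open>\<Lambda> \<times> \<Lambda>\<close> and let \<open>s\<^sub>i\<^sub>j\<close> be the parity of the permutation of
  \<open>\<Lambda> \<times> \<Lambda>\<close> that sends the position of a row to its entries in columns \<open>i\<close> and \<open>j\<close>. Passing from the
  columns \<open>i, j\<close> to \<open>i, l\<close> applies the row permutations of the Latin square of \<open>i, j, l\<close> fibrewise, so
  its row-parity is \<open>s\<^sub>i\<^sub>j + s\<^sub>i\<^sub>l\<close>, and likewise for columns and symbols. Exchanging the coordinates
  of \<open>\<Lambda> \<times> \<Lambda>\<close> is a product of \<open>n (n - 1) / 2\<close> transpositions, an even number, so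
  \<open>s\<^sub>i\<^sub>j = s\<^sub>j\<^sub>i\<close>. Thus \<open>s\<close> colours the edges of the complete graph on the columns, the
  equiparity squares are its monochromatic triangles, and Goodman's bound counts those.
\<close>

section \<open>Parities of permutations of a finite set\<close>

lemma perm_parity_cong:
  "(\<And>x. x \<in> S \<Longrightarrow> f x = g x) \<Longrightarrow> perm_parity S f = perm_parity S g"
  unfolding perm_parity_def by (metis restrict_id_cong)

lemma permutation_restrict_id:
  "finite S \<Longrightarrow> bij_betw f S S \<Longrightarrow> permutation (restrict_id f S)"
  using permutation_permutes permutes_restrict_id by blast

lemma perm_parity_comp:
  assumes "finite S" "bij_betw f S S" "bij_betw g S S"
  shows "perm_parity S (g \<circ> f) = perm_parity S g + perm_parity S f"
proof -
  have "restrict_id (g \<circ> f) S = restrict_id g S \<circ> restrict_id f S"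
    using assms(2) by (auto simp: restrict_id_def fun_eq_iff bij_betw_def)
  then show ?thesis
    using assms by (simp add: perm_parity_def evenperm_comp permutation_restrict_id)
qed

lemma bij_betw_fibrewise:
  assumes "\<And>x. x \<in> X \<Longrightarrow> bij_betw (f x) S S"
  shows "bij_betw (\<lambda>(x, y). (x, f x y)) (X \<times> S) (X \<times> S)"
  unfolding bij_betw_def
proof
  show "inj_on (\<lambda>(x, y). (x, f x y)) (X \<times> S)"
    using assms by (auto simp: inj_on_def bij_betw_def)
  show "(\<lambda>(x, y). (x, f x y)) ` (X \<times> S) = X \<times> S"
  proof -
    have "(\<lambda>(x, y). (x, f x y)) ` (X \<times> S) = (SIGMA x:X. f x ` S)" by force
    also have "\<dots> = X \<times> S" using assms by (simp add: bij_betw_def cong: Sigma_cong)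
    finally show ?thesis .
  qed
qed

text \<open>Such a map is a product of commuting permutations, each moving a single fibre
  \<open>{x} \<times> S\<close> and acting there as a copy of \<open>f x\<close>. The induction
  splits off one fibre at a time.\<close>

lemma perm_parity_fibrewise:
  assumes "finite X" "finite S" "\<And>x. x \<in> X \<Longrightarrow> bij_betw (f x) S S"
  shows "perm_parity (X \<times> S) (\<lambda>(x, y). (x, f x y)) = (\<Sum>x\<in>X. perm_parity S (f x))"
  using assms(1,3)
proof (induction X rule: finite_induct)
  case empty
  have "restrict_id (\<lambda>(x, y). (x, f x y)) ({} \<times> S) = id"
    by (auto simp: restrict_id_def)
  then show ?case by (simp add: perm_parity_def)
next
  case (insert a X)
  let ?F = "\<lambda>(x, y). (x, f x y)"
  let ?p = "restrict_id (f a) S"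
  \<comment> \<open>\<open>q\<close> is \<open>f a\<close> transported along \<open>Pair a\<close>:
    it acts on the fibre over \<open>a\<close> and fixes every other point, so its parity is that of
    \<open>f a\<close>.\<close>
  define q where "q = map_permutation S (Pair a) ?p"
  have inj: "inj_on (Pair a) S" by (simp add: inj_on_def)
  have p: "?p permutes S" using insert.prems by (simp add: permutes_restrict_id)
  have q_in: "q (a, y) = (a, f a y)" if "y \<in> S" for y
    using map_permutation_apply[OF inj that, of ?p] that by (simp add: q_def)
  have q_out: "q (x, y) = (x, y)" if "x \<noteq> a \<or> y \<notin> S" for x y
    unfolding q_def map_permutation_def using that by (auto simp: restrict_id_def)
  have fS: "f a y \<in> S" if "y \<in> S" for y
    using insert.prems[of a] that by (auto simp: bij_betw_def)
  have split: "restrict_id ?F (insert a X \<times> S) = restrict_id ?F (X \<times> S) \<circ> q"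
  proof
    fix z :: "'a \<times> 'b"
    obtain x y where z: "z = (x, y)" by (cases z)
    show "restrict_id ?F (insert a X \<times> S) z = (restrict_id ?F (X \<times> S) \<circ> q) z"
    proof (cases "x = a \<and> y \<in> S")
      case True
      then show ?thesis using insert.hyps(2) fS by (simp add: z q_in)
    next
      case False
      then show ?thesis by (auto simp: z q_out restrict_id_def)
    qed
  qed
  have "q permutes Pair a ` S"
    unfolding q_def using map_permutation_permutes[OF inj_on_imp_bij_betw[OF inj] p] .
  then have q: "permutation q"
    using assms(2) permutation_permutes by blast
  have F: "permutation (restrict_id ?F (X \<times> S))"
    using insert assms(2) by (intro permutation_restrict_id bij_betw_fibrewise) auto
  have "evenperm q = evenperm ?p"
    unfolding q_def using evenperm_map_permutation[OF inj p assms(2)] .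
  then have "perm_parity (insert a X \<times> S) ?F = perm_parity S (f a) + perm_parity (X \<times> S) ?F"
    by (simp add: perm_parity_def split evenperm_comp[OF F q])
  then show ?case using insert by simp
qed

text \<open>A fixed-point-free involution is a product of \<open>card S / 2\<close> disjoint
  transpositions. The induction removes one 2-cycle \<open>{x, f x}\<close>, which lowers the
  cardinality by 2 and flips the parity.\<close>

lemma evenperm_restrict_involution:
  assumes "finite S" "\<And>x. x \<in> S \<Longrightarrow> f x \<in> S" "\<And>x. x \<in> S \<Longrightarrow> f (f x) = x"
    "\<And>x. x \<in> S \<Longrightarrow> f x \<noteq> x"
  shows "even (card S) \<and> (evenperm (restrict_id f S) \<longleftrightarrow> 4 dvd card S)"
  using assms
proof (induction S rule: finite_psubset_induct)
  case (psubset S)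
  show ?case
  proof (cases "S = {}")
    case True
    then have "restrict_id f S = id" by (auto simp: restrict_id_def)
    then show ?thesis using True by simp
  next
    case False
    then obtain x where x: "x \<in> S" by blast
    let ?T = "S - {x, f x}"
    have fx: "f x \<in> S" "f x \<noteq> x" "f (f x) = x" using psubset.prems x by auto
    have T: "f y \<in> ?T" if "y \<in> ?T" for y
    proof -
      have y: "y \<in> S" "y \<noteq> x" "y \<noteq> f x" using that by auto
      then have "f y \<noteq> x" "f y \<noteq> f x"
        using psubset.prems(2)[OF y(1)] fx(3) by auto
      then show ?thesis using psubset.prems(1)[OF y(1)] by simp
    qed
    have IH: "even (card ?T) \<and> (evenperm (restrict_id f ?T) \<longleftrightarrow> 4 dvd card ?T)"
      using psubset.IH[of ?T] psubset.prems T x by blast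
    have "card {x, f x} = 2" using fx(2) by simp
    moreover have "card ?T = card S - card {x, f x}"
      using x fx(1) by (intro card_Diff_subset) auto
    moreover have "card {x, f x} \<le> card S"
      using x fx(1) psubset.hyps by (intro card_mono) auto
    ultimately have card: "card S = Suc (Suc (card ?T))" by linarith
    have "restrict_id f S = Transposition.transpose x (f x) \<circ> restrict_id f ?T"
    proof
      fix y
      show "restrict_id f S y = (Transposition.transpose x (f x) \<circ> restrict_id f ?T) y"
      proof (cases "y \<in> ?T")
        case True
        then show ?thesis using T[OF True] by (auto simp: transpose_def)
      next
        case False
        then show ?thesis using x fx by (auto simp: restrict_id_def transpose_def)
      qed
    qed
    moreover have "bij_betw f ?T ?T"
      by (rule bij_betwI[of _ _ _ f]) (use T psubset.prems in auto)
    then have "permutation (restrict_id f ?T)"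
      using psubset.hyps by (intro permutation_restrict_id) auto
    ultimately have "evenperm (restrict_id f S) \<longleftrightarrow> \<not> evenperm (restrict_id f ?T)"
      using fx(2) by (simp add: evenperm_comp permutation_swap_id evenperm_swap)
    moreover have "even (card S)" using IH by (simp add: card)
    \<comment> \<open>Adding 2 toggles divisibility by 4 only among even numbers, which is why
      evenness of \<open>card S\<close> is carried through the induction.\<close>
    moreover have "4 dvd Suc (Suc m) \<longleftrightarrow> \<not> 4 dvd m" if "even m" for m :: nat
      using that by presburger
    then have "4 dvd card S \<longleftrightarrow> \<not> 4 dvd card ?T"
      using IH unfolding card by blast
    ultimately show ?thesis using IH by blast
  qed
qed

text \<open>The swap fixes the diagonal and is a fixed-point-free involution on the remaining
  \<open>card S * (card S - 1)\<close> points, a multiple of 4 by the congruence.\<close>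

lemma perm_parity_swap:
  assumes "finite S" "card S mod 4 = 1"
  shows "perm_parity (S \<times> S) prod.swap = 0"
proof -
  let ?D = "(\<lambda>x. (x, x)) ` S"
  let ?E = "S \<times> S - ?D"
  have eq: "restrict_id prod.swap (S \<times> S) = restrict_id prod.swap ?E"
    by (auto simp: restrict_id_def fun_eq_iff)
  have E: "even (card ?E) \<and> (evenperm (restrict_id prod.swap ?E) \<longleftrightarrow> 4 dvd card ?E)"
  proof (rule evenperm_restrict_involution)
    fix p assume p: "p \<in> ?E"
    obtain x y where xy: "p = (x, y)" by (cases p)
    have "x \<in> S" "y \<in> S" "x \<noteq> y" using p xy by auto
    then show "prod.swap p \<in> ?E" "prod.swap p \<noteq> p" using xy by auto
  qed (use assms(1) in auto)
  have "card ?D = card S"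
    by (intro card_image) (simp add: inj_on_def)
  then have card: "card ?E = card S * (card S - 1)"
    using assms(1) by (subst card_Diff_subset) (auto simp: card_cartesian_product diff_mult_distrib2)
  have "4 dvd card S - 1" using assms(2) by presburger
  then have "4 dvd card S * (card S - 1)" by (rule dvd_mult)
  then have "4 dvd card ?E" by (subst card)
  then have "evenperm (restrict_id prod.swap ?E)" using E by blast
  then have "evenperm (restrict_id prod.swap (S \<times> S))" by (subst eq)
  then show ?thesis unfolding perm_parity_def by (rule if_P)
qed

section \<open>Goodman's bound\<close>

lemma sum_square_symmetric:
  fixes h :: "nat \<Rightarrow> nat \<Rightarrow> int"
  assumes "\<And>i j. h i j = h j i"
  shows "(\<Sum>i<N. \<Sum>j<N. h i j) = 2 * (\<Sum>j<N. \<Sum>i<j. h i j) + (\<Sum>i<N. h i i)"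
proof (induction N)
  case (Suc N)
  have "(\<Sum>j<N. h N j) = (\<Sum>j<N. h j N)" using assms by (intro sum.cong) auto
  then show ?case using Suc by (simp add: sum.distrib)
qed simp

text \<open>For a signed edge colouring \<open>e\<close>, the row sum at \<open>i\<close> is the
  signed degree of \<open>i\<close>. Expanding its square gives each pair of distinct edges at
  \<open>i\<close> twice, and such a pair lies in exactly one triangle; the squares of single edges
  contribute \<open>N - 1\<close> at each vertex.\<close>

lemma sum_triangle_products:
  fixes e :: "nat \<Rightarrow> nat \<Rightarrow> int"
  assumes sym: "\<And>i j. e i j = e j i" and diag: "\<And>i. e i i = 0"
    and sq: "\<And>i j. i \<noteq> j \<Longrightarrow> e i j * e i j = 1"
  shows "2 * (\<Sum>l<N. \<Sum>j<l. \<Sum>i<j. e i j * e i l + e i j * e j l + e i l * e j l)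
    = (\<Sum>i<N. (\<Sum>j<N. e i j)\<^sup>2) - int N * (int N - 1)"
proof (induction N)
  case (Suc N)
  \<comment> \<open>\<open>?h i j\<close> is the contribution of the triangle \<open>i, j, N\<close>
    created by the new vertex \<open>N\<close>. It is summed first over all ordered pairs, where the
    sum factorises; the diagonal terms reduce to \<open>e i N * e i N\<close>.\<close>
  let ?h = "\<lambda>i j. e i j * e i N + e i j * e j N + e i N * e j N"
  let ?S = "\<lambda>i. \<Sum>j<N. e i j"
  have sq': "(\<Sum>i<N. e i N * e i N) = int N" by (simp add: sq)
  have 1: "(\<Sum>i<N. \<Sum>j<N. e i j * e i N) = (\<Sum>i<N. ?S i * e i N)"
    by (simp add: sum_distrib_right)
  have 2: "(\<Sum>i<N. \<Sum>j<N. e i j * e j N) = (\<Sum>i<N. ?S i * e i N)"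
    by (subst sum.swap) (simp add: sum_distrib_right sym)
  have 3: "(\<Sum>i<N. \<Sum>j<N. e i N * e j N) = (?S N)\<^sup>2"
    by (simp add: power2_eq_square sum_product sym)
  have "(\<Sum>i<N. \<Sum>j<N. ?h i j) = 2 * (\<Sum>i<N. ?S i * e i N) + (?S N)\<^sup>2"
    by (simp add: sum.distrib 1 2 3)
  moreover have "(\<Sum>i<N. \<Sum>j<N. ?h i j) = 2 * (\<Sum>j<N. \<Sum>i<j. ?h i j) + (\<Sum>i<N. ?h i i)"
    by (rule sum_square_symmetric) (simp add: sym algebra_simps)
  moreover have "(\<Sum>i<N. ?h i i) = int N" by (simp add: diag sq')
  ultimately have gain: "2 * (\<Sum>j<N. \<Sum>i<j. ?h i j)
      = 2 * (\<Sum>i<N. ?S i * e i N) + (?S N)\<^sup>2 - int N"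
    by linarith
  have "(\<Sum>i<N. (\<Sum>j<Suc N. e i j)\<^sup>2)
      = (\<Sum>i<N. (?S i)\<^sup>2) + 2 * (\<Sum>i<N. ?S i * e i N) + int N"
  proof -
    have "(\<Sum>j<Suc N. e i j)\<^sup>2 = (?S i)\<^sup>2 + 2 * (?S i * e i N) + e i N * e i N" for i
      by (simp add: power2_eq_square distrib_left distrib_right)
    then show ?thesis
      by (simp only: sum.distrib sum_distrib_left[symmetric] sq')
  qed
  then show ?case using Suc gain by (simp add: diag algebra_simps)
qed simp

lemma sum_triangles_one:
  "6 * (\<Sum>l<N. \<Sum>j<l. \<Sum>i<j. 1) = int N * (int N - 1) * (int N - 2)"
proof -
  have pairs: "2 * (\<Sum>j<l. int j) = int l * (int l - 1)" for l
    by (induction l) (auto simp: algebra_simps)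
  have "6 * (\<Sum>l<N. \<Sum>j<l. int j) = int N * (int N - 1) * (int N - 2)"
  proof (induction N)
    case (Suc N)
    then show ?case using pairs[of N] by (simp add: algebra_simps)
  qed simp
  then show ?thesis by simp
qed

text \<open>With edge signs 1 and -1, the three pairwise products in a triangle add up to 3 if it is
  monochromatic and to -1 otherwise. Four times the count is therefore the number of triangles plus
  the sum of these products, and the latter is bounded below because, for even \<open>N\<close>,
  every signed degree is odd and has square at least 1.\<close>

lemma Goodman:
  assumes sym: "\<And>i j. red i j \<longleftrightarrow> red j i" and "even N"
  shows "int N * (int N - 2) * (int N - 4) \<le>
    24 * int (card {(i, j, l). i < j \<and> j < l \<and> l < N \<and> red i j = red i l \<and> red i j = red j l})"
proof -
  define e :: "nat \<Rightarrow> nat \<Rightarrow> int"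
    where "e i j = (if i = j then 0 else if red i j then 1 else - 1)" for i j
  let ?M = "\<lambda>i j l. red i j = red i l \<and> red i j = red j l"
  let ?P = "\<lambda>i j l. e i j * e i l + e i j * e j l + e i l * e j l"
  have odd_row: "odd (\<Sum>j<N. e i j)" if "i < N" for i
  proof -
    have "(\<Sum>j<N. e i j) = (\<Sum>j\<in>{..<N} - {i}. e i j)"
      using that by (subst sum.remove[of _ i]) (auto simp: e_def)
    \<comment> \<open>Each of the \<open>N - 1\<close> signs becomes 0 or 2 when 1 is added.\<close>
    moreover have "even (\<Sum>j\<in>{..<N} - {i}. e i j + 1)"
      by (intro dvd_sum) (auto simp: e_def)
    then have "even ((\<Sum>j\<in>{..<N} - {i}. e i j) + (int N - 1))"
      using that by (simp add: sum.distrib of_nat_diff)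
    ultimately show ?thesis using \<open>even N\<close> by simp
  qed
  have "1 \<le> (\<Sum>j<N. e i j)\<^sup>2" if "i < N" for i
    using odd_row[OF that] by (smt (verit) even_zero power_eq_0_iff zero_le_power2)
  then have "(\<Sum>i<N. 1) \<le> (\<Sum>i<N. (\<Sum>j<N. e i j)\<^sup>2)"
    by (intro sum_mono) auto
  moreover have "2 * (\<Sum>l<N. \<Sum>j<l. \<Sum>i<j. ?P i j l)
      = (\<Sum>i<N. (\<Sum>j<N. e i j)\<^sup>2) - int N * (int N - 1)"
    by (rule sum_triangle_products) (auto simp: e_def sym)
  ultimately have P: "2 * (\<Sum>l<N. \<Sum>j<l. \<Sum>i<j. ?P i j l) \<ge> int N - int N * (int N - 1)"
    by simp
  \<comment> \<open>The nested sums have the largest index outermost, so the triples are reversed to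
    form an iterated \<open>SIGMA\<close>.\<close>
  have "{(i, j, l). i < j \<and> j < l \<and> l < N \<and> ?M i j l}
      = (\<lambda>(l, j, i). (i, j, l)) ` (SIGMA l:{..<N}. SIGMA j:{..<l}. {i. i < j \<and> ?M i j l})"
    by (auto simp: image_iff)
  then have "card {(i, j, l). i < j \<and> j < l \<and> l < N \<and> ?M i j l}
      = card (SIGMA l:{..<N}. SIGMA j:{..<l}. {i. i < j \<and> ?M i j l})"
    by (simp add: card_image inj_on_def)
  also have "\<dots> = (\<Sum>l<N. \<Sum>j<l. card {i. i < j \<and> ?M i j l})"
    by (simp add: card_SigmaI)
  also have "int \<dots> = (\<Sum>l<N. \<Sum>j<l. \<Sum>i<j. of_bool (?M i j l))"
    by (simp add: sum.If_cases of_bool_def Collect_conj_eq lessThan_def)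
  finally have card: "int (card {(i, j, l). i < j \<and> j < l \<and> l < N \<and> ?M i j l})
      = (\<Sum>l<N. \<Sum>j<l. \<Sum>i<j. of_bool (?M i j l))" .
  have "4 * of_bool (?M i j l) = 1 + ?P i j l" if "i < j" "j < l" for i j l
    using that by (auto simp: e_def)
  then have "4 * (\<Sum>l<N. \<Sum>j<l. \<Sum>i<j. of_bool (?M i j l))
      = (\<Sum>l<N. \<Sum>j<l. \<Sum>i<j. 1 + ?P i j l)"
    unfolding sum_distrib_left by (intro sum.cong) auto
  also have "\<dots> = (\<Sum>l<N. \<Sum>j<l. \<Sum>i<j. 1) + (\<Sum>l<N. \<Sum>j<l. \<Sum>i<j. ?P i j l)"
    by (simp only: sum.distrib)
  finally have "24 * int (card {(i, j, l). i < j \<and> j < l \<and> l < N \<and> ?M i j l})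
      = 6 * (\<Sum>l<N. \<Sum>j<l. \<Sum>i<j. 1) + 6 * (\<Sum>l<N. \<Sum>j<l. \<Sum>i<j. ?P i j l)"
    unfolding card by linarith
  moreover have "int N * (int N - 2) * (int N - 4)
      = int N * (int N - 1) * (int N - 2) + 3 * (int N - int N * (int N - 1))"
    by (simp add: algebra_simps)
  \<comment> \<open>Here \<open>a\<close> is six times the number of triangles, \<open>p\<close> the
    sum of the products and \<open>m\<close> the lower bound for \<open>2 * p\<close>; naming them
    leaves a linear problem.\<close>
  moreover have "b \<le> c" if "c = a + 6 * p" "b = a + 3 * m" "m \<le> 2 * p" for a b c m p :: int
    using that by linarith
  ultimately show ?thesis
    using P unfolding sum_triangles_one by blast
qed

section \<open>The edge colouring of an orthogonal array\<close>

text \<open>The map \<open>R\<close> labels the array rows by positions, so that reading two columns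
  becomes a self-map of \<open>\<Lambda> \<times> \<Lambda>\<close> and has a parity. For an
  orthogonal array, another bijection \<open>R\<close> shifts the values at all pairs of distinct
  columns by the same amount, so comparisons between them are independent of the choice.\<close>

definition pair_parity :: "'a set \<Rightarrow> (nat \<Rightarrow> nat \<Rightarrow> 'a) \<Rightarrow> ('a \<times> 'a \<Rightarrow> nat) \<Rightarrow> nat \<Rightarrow> nat \<Rightarrow> bit" where
  "pair_parity \<Lambda> A R i j = perm_parity (\<Lambda> \<times> \<Lambda>) (\<lambda>p. (A (R p) i, A (R p) j))"

lemma bij_betw_two_columns:
  assumes OA: "orthogonal_array k n \<Lambda> A" and c: "i < k" "j < k" "i \<noteq> j"
  shows "bij_betw (\<lambda>r. (A r i, A r j)) {..<n\<^sup>2} (\<Lambda> \<times> \<Lambda>)"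
proof -
  have ex1: "\<exists>!r. r < n\<^sup>2 \<and> A r i = x \<and> A r j = y" if "x \<in> \<Lambda>" "y \<in> \<Lambda>" for x y
    using OA c that by (auto simp: orthogonal_array_def)
  have mem: "A r i \<in> \<Lambda>" "A r j \<in> \<Lambda>" if "r < n\<^sup>2" for r
    using OA c that by (auto simp: orthogonal_array_def)
  show ?thesis
    unfolding bij_betw_def
  proof
    show "inj_on (\<lambda>r. (A r i, A r j)) {..<n\<^sup>2}"
      using ex1 mem by (auto simp: inj_on_def)
    show "(\<lambda>r. (A r i, A r j)) ` {..<n\<^sup>2} = \<Lambda> \<times> \<Lambda>"
    proof (intro equalityI subsetI)
      fix p assume "p \<in> \<Lambda> \<times> \<Lambda>"
      then obtain x y where p: "p = (x, y)" "x \<in> \<Lambda>" "y \<in> \<Lambda>" by blast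
      then obtain r where "r < n\<^sup>2" "A r i = x" "A r j = y" using ex1 by blast
      then show "p \<in> (\<lambda>r. (A r i, A r j)) ` {..<n\<^sup>2}" using p(1) by auto
    qed (use mem in auto)
  qed
qed

context
  fixes k n :: nat and \<Lambda> :: "'a set" and A :: "nat \<Rightarrow> nat \<Rightarrow> 'a" and R :: "'a \<times> 'a \<Rightarrow> nat"
  assumes OA: "orthogonal_array k n \<Lambda> A" and R: "bij_betw R (\<Lambda> \<times> \<Lambda>) {..<n\<^sup>2}"
begin

lemma finite_alphabet: "finite \<Lambda>"
  using OA by (simp add: orthogonal_array_def)

lemma R_less: "p \<in> \<Lambda> \<times> \<Lambda> \<Longrightarrow> R p < n\<^sup>2"
  using bij_betwE[OF R] by blast

lemma bij_betw_pair:
  assumes "i < k" "j < k" "i \<noteq> j"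
  shows "bij_betw (\<lambda>p. (A (R p) i, A (R p) j)) (\<Lambda> \<times> \<Lambda>) (\<Lambda> \<times> \<Lambda>)"
  using bij_betw_trans[OF R bij_betw_two_columns[OF OA assms]] by (simp add: comp_def)

lemma pair_parity_sym:
  assumes "n mod 4 = 1" "i < k" "j < k"
  shows "pair_parity \<Lambda> A R i j = pair_parity \<Lambda> A R j i"
proof (cases "i = j")
  case False
  let ?f = "\<lambda>p. (A (R p) i, A (R p) j)"
  have "card \<Lambda> mod 4 = 1" using OA assms(1) by (simp add: orthogonal_array_def)
  then have "perm_parity (\<Lambda> \<times> \<Lambda>) prod.swap = 0"
    using perm_parity_swap finite_alphabet by blast
  moreover have "bij_betw prod.swap (\<Lambda> \<times> \<Lambda>) (\<Lambda> \<times> \<Lambda>)"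
    by (rule bij_betwI[of _ _ _ prod.swap]) auto
  ultimately have "perm_parity (\<Lambda> \<times> \<Lambda>) (prod.swap \<circ> ?f) = perm_parity (\<Lambda> \<times> \<Lambda>) ?f"
    using perm_parity_comp[OF _ bij_betw_pair[of i j]] finite_alphabet False assms by simp
  then show ?thesis by (simp add: pair_parity_def comp_def)
qed simp

lemma row_parity_ensemble_square:
  assumes c: "i < k" "j < k" "l < k" "i \<noteq> j" "i \<noteq> l" "j \<noteq> l"
  shows "row_parity \<Lambda> (ensemble_square n A i j l) = pair_parity \<Lambda> A R i j + pair_parity \<Lambda> A R i l"
proof -
  let ?L = "ensemble_square n A i j l"
  let ?F = "\<lambda>(x, y). (x, ?L x y)"
  let ?f = "\<lambda>p. (A (R p) i, A (R p) j)"
  have L: "bij_betw (?L x) \<Lambda> \<Lambda>" if "x \<in> \<Lambda>" for x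
    using latin_square_ensemble_square[OF OA c] that by (simp add: latin_square_def)
  have "pair_parity \<Lambda> A R i l = perm_parity (\<Lambda> \<times> \<Lambda>) (?F \<circ> ?f)"
    unfolding pair_parity_def
    by (rule perm_parity_cong) (simp add: ensemble_square_eq[OF OA c(1,2,4) R_less])
  also have "\<dots> = perm_parity (\<Lambda> \<times> \<Lambda>) ?F + perm_parity (\<Lambda> \<times> \<Lambda>) ?f"
    using finite_alphabet c L
    by (intro perm_parity_comp bij_betw_pair bij_betw_fibrewise) auto
  also have "perm_parity (\<Lambda> \<times> \<Lambda>) ?F = row_parity \<Lambda> ?L"
    unfolding row_parity_def using finite_alphabet L by (intro perm_parity_fibrewise) auto
  finally show ?thesis
    \<comment> \<open>In characteristic 2 a summand moves across the equation unchanged, so it can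
      be solved for the row-parity.\<close>
    unfolding pair_parity_def by (cases "row_parity \<Lambda> ?L"; cases "perm_parity (\<Lambda> \<times> \<Lambda>) ?f") auto
qed

end

text \<open>Exchanging the first two of the chosen columns transposes the square.\<close>

lemma column_parity_ensemble_square:
  "column_parity \<Lambda> (ensemble_square n A i j l) = row_parity \<Lambda> (ensemble_square n A j i l)"
proof -
  have "ensemble_square n A i j l x y = ensemble_square n A j i l y x" for x y
    unfolding ensemble_square_def by (rule arg_cong[of _ _ The]) auto
  then show ?thesis by (simp add: column_parity_def row_parity_def)
qed

text \<open>An array row with entries \<open>x\<close>, \<open>y\<close>, \<open>s\<close> in
  columns \<open>i\<close>, \<open>j\<close>, \<open>l\<close> says both that \<open>s\<close>
  stands in cell \<open>(x, y)\<close> of the first square and that \<open>y\<close> stands in cell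
  \<open>(s, x)\<close> of the second. Hence the permutation belonging to the symbol
  \<open>s\<close> is row \<open>s\<close> of the second square.\<close>

lemma symbol_parity_ensemble_square:
  assumes OA: "orthogonal_array k n \<Lambda> A"
    and c: "i < k" "j < k" "l < k" "i \<noteq> j" "i \<noteq> l" "j \<noteq> l"
  shows "symbol_parity \<Lambda> (ensemble_square n A i j l) = row_parity \<Lambda> (ensemble_square n A l i j)"
proof -
  let ?L = "ensemble_square n A i j l"
  have "(THE y. y \<in> \<Lambda> \<and> ?L x y = s) = ensemble_square n A l i j s x"
    if xs: "x \<in> \<Lambda>" "s \<in> \<Lambda>" for x s
  proof -
    have "(s, x) \<in> (\<lambda>r. (A r l, A r i)) ` {..<n\<^sup>2}"
      using bij_betw_two_columns[OF OA c(3,1)] c xs by (auto simp: bij_betw_def)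
    then obtain r where r: "r < n\<^sup>2" "s = A r l" "x = A r i" by auto
    have y: "A r j \<in> \<Lambda>" using OA r c by (auto simp: orthogonal_array_def)
    have inj: "inj_on (?L x) \<Lambda>"
      using latin_square_ensemble_square[OF OA c] xs by (simp add: latin_square_def bij_betw_def)
    have "?L x (A r j) = s"
      using ensemble_square_eq[OF OA c(1,2,4) r(1), of l] by (simp add: r)
    then have "(THE y. y \<in> \<Lambda> \<and> ?L x y = s) = A r j"
      using y inj by (intro the_equality) (auto intro: inj_onD)
    also have "\<dots> = ensemble_square n A l i j s x"
      using ensemble_square_eq[OF OA c(3,1) _ r(1), of j] c by (simp add: r)
    finally show ?thesis .
  qed
  then show ?thesis
    unfolding symbol_parity_def row_parity_def by (intro sum.cong perm_parity_cong) auto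
qed

text \<open>The row-, column- and symbol-parity are the sums of the two edge colours at the vertices
  \<open>i\<close>, \<open>j\<close> and \<open>l\<close> of the triangle. Equating two of them
  cancels the edge joining their vertices and leaves equality of the other two edges.\<close>

lemma equiparity_ensemble_square_iff:
  assumes OA: "orthogonal_array k n \<Lambda> A" and R: "bij_betw R (\<Lambda> \<times> \<Lambda>) {..<n\<^sup>2}"
    and n: "n mod 4 = 1"
    and c: "i < k" "j < k" "l < k" "i \<noteq> j" "i \<noteq> l" "j \<noteq> l"
  defines "s \<equiv> pair_parity \<Lambda> A R"
  shows "equiparity_latin_square \<Lambda> (ensemble_square n A i j l) \<longleftrightarrow> s i j = s i l \<and> s i j = s j l"
proof -
  note sym = pair_parity_sym[OF OA R n, folded s_def]
  note row = row_parity_ensemble_square[OF OA R, folded s_def]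
  have "row_parity \<Lambda> (ensemble_square n A i j l) = s i j + s i l"
    using row[of i j l] c by simp
  moreover have "column_parity \<Lambda> (ensemble_square n A i j l) = s i j + s j l"
    using row[of j i l] sym[of i j] c by (simp add: column_parity_ensemble_square)
  moreover have "symbol_parity \<Lambda> (ensemble_square n A i j l) = s i l + s j l"
    using row[of l i j] sym[of i l] sym[of j l] c by (simp add: symbol_parity_ensemble_square[OF OA c])
  ultimately show ?thesis
    using latin_square_ensemble_square[OF OA c]
    unfolding equiparity_latin_square_def
    by (cases "s i j"; cases "s i l"; cases "s j l") simp_all
qed

theorem theorem6p4:
  fixes n :: nat and \<Lambda> :: "'a set" and A :: "nat \<Rightarrow> nat \<Rightarrow> 'a"
  assumes "n \<ge> 2" and "n mod 4 = 1"
    and "orthogonal_array (n + 1) n \<Lambda> A"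
  shows "real (card {(i, j, l). i < j \<and> j < l \<and> l < n + 1 \<and>
             equiparity_latin_square \<Lambda> (ensemble_square n A i j l)})
         \<ge> (real n + 1) * (real n - 1) * (real n - 3) / 24"
proof -
  \<comment> \<open>Any bijective labelling serves; inverting the reading of columns 0 and 1
    provides one.\<close>
  define R where "R = inv_into {..<n\<^sup>2} (\<lambda>r. (A r 0, A r 1))"
  have R: "bij_betw R (\<Lambda> \<times> \<Lambda>) {..<n\<^sup>2}"
    unfolding R_def using bij_betw_two_columns[OF assms(3), of 0 1] assms(1)
    by (intro bij_betw_inv_into) auto
  \<comment> \<open>The range conditions make \<open>red\<close> symmetric on all of
    \<open>nat\<close>, as \<open>Goodman\<close> requires; \<open>pair_parity\<close> is known to
    be symmetric only between columns of the array.\<close>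
  define red where "red i j \<longleftrightarrow> i < n + 1 \<and> j < n + 1 \<and> pair_parity \<Lambda> A R i j = 1" for i j
  have "red i j \<longleftrightarrow> red j i" for i j
    using pair_parity_sym[OF assms(3) R assms(2)] by (auto simp: red_def)
  moreover have "even (n + 1)" using assms(2) by presburger
  ultimately have "int (n + 1) * (int (n + 1) - 2) * (int (n + 1) - 4) \<le> 24 * int (card
      {(i, j, l). i < j \<and> j < l \<and> l < n + 1 \<and> red i j = red i l \<and> red i j = red j l})"
    by (rule Goodman)
  moreover have "red i j = red i l \<and> red i j = red j l \<longleftrightarrow>
      equiparity_latin_square \<Lambda> (ensemble_square n A i j l)"
    if "i < j" "j < l" "l < n + 1" for i j l
  proof -
    have "red a b = red c d \<longleftrightarrow> pair_parity \<Lambda> A R a b = pair_parity \<Lambda> A R c d"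
      if "a < n + 1" "b < n + 1" "c < n + 1" "d < n + 1" for a b c d
      using that unfolding red_def
      by (cases "pair_parity \<Lambda> A R a b"; cases "pair_parity \<Lambda> A R c d") auto
    then show ?thesis
      using equiparity_ensemble_square_iff[OF assms(3) R assms(2), of i j l] that by simp
  qed
  then have "{(i, j, l). i < j \<and> j < l \<and> l < n + 1 \<and> red i j = red i l \<and> red i j = red j l}
      = {(i, j, l). i < j \<and> j < l \<and> l < n + 1 \<and>
          equiparity_latin_square \<Lambda> (ensemble_square n A i j l)}"
    by blast
  ultimately have "int (n + 1) * (int (n + 1) - 2) * (int (n + 1) - 4) \<le> 24 * int (card
      {(i, j, l). i < j \<and> j < l \<and> l < n + 1 \<and>
        equiparity_latin_square \<Lambda> (ensemble_square n A i j l)})" (is "?a \<le> 24 * int ?c")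
    by simp
  then have "real_of_int ?a \<le> real_of_int (24 * int ?c)"
    by (subst of_int_le_iff)
  moreover have "real_of_int ?a = (real n + 1) * (real n - 1) * (real n - 3)"
    by simp
  moreover have "real_of_int (24 * int ?c) = 24 * real ?c"
    by (simp only: of_int_mult of_int_numeral of_int_of_nat_eq)
  ultimately show ?thesis by linarith
qed

end
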